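(* Let a finite group $G$ act on a finite Abelian group $A$ by group automorphisms. For all orbits $\mathcal{O}\in{}_G\backslash A$ and $\mathcal{P}\in{}_G\backslash\hat A$, the zonal spherical function $\omega_{\mathcal{P}}$ of the Gelfand pair $(A\rtimes G,G)$ corresponding to $W_{\mathcal{P}}$ satisfies $$\omega_{\mathcal{P}}(\mathcal{O})=\frac{1}{|\mathcal{O}|}\,\overline{\varPhi(\mathcal{P},\mathcal{O})}.$$
   Context: $\hat A$ is the character group of $A$. If $\rho$ denotes the action of $G$ on $A$, $G$ acts on $\hat A$ by $\hat\rho(g)\xi=\xi\circ\rho(g^{-1})$. ${}_G\backslash A$ and ${}_G\backslash\hat A$ are the sets of $G$-orbits; a $G$-invariant function on $A$ is regarded as a function on orbits. The canonical matrix is $$\varPhi(\mathcal{P},\mathcal{O})=\sum_{a\in\mathcal{O}}\overline{\xi(a)},\qquad\xi\in\mathcal{P}\text{ arbitrary}$$ (independent of $\xi\in\mathcal{P}$). The group $\mathbb{G}=A\rtimes G$ acts transitively on $A$ by $\tau(b,g)a=b+\rho(g)a$, so $A\cong\mathbb{G}/G$ and $\mathbb{C}[A]$ is a representation of $\mathbb{G}$. $(\mathbb{G},G)$ is a Gelfand pair, i.e. every irreducible representation of $\mathbb{G}$ has an at most one-dimensional $G$-fixed subspace; irreducible representations with one-dimensional $G$-fixed subspace are called spherical. For $\mathcal{P}\in{}_G\backslash\hat A$, $W_{\mathcal{P}}=\operatorname{Span}_{\mathbb{C}}\mathcal{P}\subset\mathbb{C}[A]$ is a spherical subrepresentation, and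 $\omega_{\mathcal{P}}$, the zonal spherical function corresponding to $W_{\mathcal{P}}$, is the unique $G$-invariant function in $W_{\mathcal{P}}$ with $\omega_{\mathcal{P}}(0)=1$. *)

theory Defs
  imports Complex_Main "HOL-Algebra.Group_Action" "HOL-Library.Function_Algebras"
begin

section \<open>Complex vector spaces of functions\<close>

definition scale_fun :: "complex \<Rightarrow> ('x \<Rightarrow> complex) \<Rightarrow> 'x \<Rightarrow> complex"
  where "scale_fun c f = (\<lambda>x. c * f x)"

interpretation cfun: vector_space scale_fun
  by standard (auto simp: scale_fun_def algebra_simps fun_eq_iff)

text \<open>Functions on a carrier set \<open>X\<close> are represented by functions on the whole type that
  vanish outside \<open>X\<close>; unlike the convention with \<open>undefined\<close>, this makes \<open>\<complex>[X]\<close> a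
  subspace.\<close>

definition functions_on :: "'x set \<Rightarrow> ('x \<Rightarrow> complex) set"
  where "functions_on X = {f. \<forall>x. x \<notin> X \<longrightarrow> f x = 0}"

text \<open>The translation action of \<open>K\<close> on \<open>\<complex>[X]\<close> induced by an action \<open>\<phi>\<close> of \<open>K\<close> on \<open>X\<close>:
  \<open>f \<mapsto> f \<circ> \<phi> k\<^sup>-\<^sup>1\<close>.\<close>

definition translate :: "('k, 'm) monoid_scheme \<Rightarrow> 'x set \<Rightarrow> ('k \<Rightarrow> 'x \<Rightarrow> 'x)
    \<Rightarrow> 'k \<Rightarrow> ('x \<Rightarrow> complex) \<Rightarrow> 'x \<Rightarrow> complex"
  where "translate K X \<phi> k f = (\<lambda>x. if x \<in> X then f (\<phi> (inv\<^bsub>K\<^esub> k) x) else 0)"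


section \<open>Finite-dimensional representations and Gelfand pairs\<close>

definition representation :: "('k, 'm) monoid_scheme \<Rightarrow> ('x \<Rightarrow> complex) set
    \<Rightarrow> ('k \<Rightarrow> ('x \<Rightarrow> complex) \<Rightarrow> 'x \<Rightarrow> complex) \<Rightarrow> bool"
  where "representation K V R \<longleftrightarrow>
    cfun.subspace V \<and> (\<exists>B. finite B \<and> V = cfun.span B) \<and>
    (\<forall>k\<in>carrier K. \<forall>v\<in>V. R k v \<in> V) \<and>
    (\<forall>k\<in>carrier K. \<forall>v\<in>V. \<forall>w\<in>V. R k (v + w) = R k v + R k w) \<and>
    (\<forall>k\<in>carrier K. \<forall>c. \<forall>v\<in>V. R k (scale_fun c v) = scale_fun c (R k v)) \<and>
    (\<forall>v\<in>V. R \<one>\<^bsub>K\<^esub> v = v) \<and>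
    (\<forall>k\<in>carrier K. \<forall>l\<in>carrier K. \<forall>v\<in>V. R (k \<otimes>\<^bsub>K\<^esub> l) v = R k (R l v))"

definition subrepresentation :: "('k, 'm) monoid_scheme \<Rightarrow> ('x \<Rightarrow> complex) set
    \<Rightarrow> ('x \<Rightarrow> complex) set \<Rightarrow> ('k \<Rightarrow> ('x \<Rightarrow> complex) \<Rightarrow> 'x \<Rightarrow> complex) \<Rightarrow> bool"
  where "subrepresentation K W V R \<longleftrightarrow>
    representation K V R \<and> W \<subseteq> V \<and> cfun.subspace W \<and>
    (\<forall>k\<in>carrier K. \<forall>w\<in>W. R k w \<in> W)"

definition irreducible_representation :: "('k, 'm) monoid_scheme \<Rightarrow> ('x \<Rightarrow> complex) set
    \<Rightarrow> ('k \<Rightarrow> ('x \<Rightarrow> complex) \<Rightarrow> 'x \<Rightarrow> complex) \<Rightarrow> bool"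
  where "irreducible_representation K V R \<longleftrightarrow>
    representation K V R \<and> V \<noteq> {0} \<and>
    (\<forall>W. subrepresentation K W V R \<longrightarrow> W = {0} \<or> W = V)"

definition fixed_vectors :: "'k set \<Rightarrow> ('x \<Rightarrow> complex) set
    \<Rightarrow> ('k \<Rightarrow> ('x \<Rightarrow> complex) \<Rightarrow> 'x \<Rightarrow> complex) \<Rightarrow> ('x \<Rightarrow> complex) set"
  where "fixed_vectors H V R = {v \<in> V. \<forall>h\<in>H. R h v = v}"

text \<open>It suffices to quantify over representations on finite-dimensional spaces of complex
  sequences: irreducible representations of a finite group are finite-dimensional, and every
  finite-dimensional complex vector space is isomorphic to such a space.\<close>

definition gelfand_pair :: "('k, 'm) monoid_scheme \<Rightarrow> 'k set \<Rightarrow> bool"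
  where "gelfand_pair K H \<longleftrightarrow>
    group K \<and> finite (carrier K) \<and> subgroup H K \<and>
    (\<forall>(V :: (nat \<Rightarrow> complex) set) R.
       irreducible_representation K V R \<longrightarrow> cfun.dim (fixed_vectors H V R) \<le> 1)"

definition spherical_representation :: "('k, 'm) monoid_scheme \<Rightarrow> 'k set
    \<Rightarrow> ('x \<Rightarrow> complex) set \<Rightarrow> ('k \<Rightarrow> ('x \<Rightarrow> complex) \<Rightarrow> 'x \<Rightarrow> complex) \<Rightarrow> bool"
  where "spherical_representation K H V R \<longleftrightarrow>
    irreducible_representation K V R \<and> cfun.dim (fixed_vectors H V R) = 1"


section \<open>The pair \<open>(A \<rtimes> G, G)\<close>\<close>

definition semidirect_product :: "('a, 'm) monoid_scheme \<Rightarrow> ('g, 'n) monoid_scheme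
    \<Rightarrow> ('g \<Rightarrow> 'a \<Rightarrow> 'a) \<Rightarrow> ('a \<times> 'g) monoid"
  where "semidirect_product A G \<rho> =
    \<lparr>carrier = carrier A \<times> carrier G,
     mult = (\<lambda>(a, g) (b, h). (a \<otimes>\<^bsub>A\<^esub> \<rho> g b, g \<otimes>\<^bsub>G\<^esub> h)),
     one = (\<one>\<^bsub>A\<^esub>, \<one>\<^bsub>G\<^esub>)\<rparr>"

definition embedded_factor :: "('a, 'm) monoid_scheme \<Rightarrow> ('g, 'n) monoid_scheme \<Rightarrow> ('a \<times> 'g) set"
  where "embedded_factor A G = {\<one>\<^bsub>A\<^esub>} \<times> carrier G"

definition affine_action :: "('a, 'm) monoid_scheme \<Rightarrow> ('g \<Rightarrow> 'a \<Rightarrow> 'a) \<Rightarrow> 'a \<times> 'g \<Rightarrow> 'a \<Rightarrow> 'a"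
  where "affine_action A \<rho> = (\<lambda>(b, g) a. b \<otimes>\<^bsub>A\<^esub> \<rho> g a)"

definition affine_representation :: "('a, 'm) monoid_scheme \<Rightarrow> ('g, 'n) monoid_scheme
    \<Rightarrow> ('g \<Rightarrow> 'a \<Rightarrow> 'a) \<Rightarrow> 'a \<times> 'g \<Rightarrow> ('a \<Rightarrow> complex) \<Rightarrow> 'a \<Rightarrow> complex"
  where "affine_representation A G \<rho> =
    translate (semidirect_product A G \<rho>) (carrier A) (affine_action A \<rho>)"

definition is_zonal_spherical :: "('a, 'm) monoid_scheme \<Rightarrow> ('g, 'n) monoid_scheme
    \<Rightarrow> ('g \<Rightarrow> 'a \<Rightarrow> 'a) \<Rightarrow> ('a \<Rightarrow> complex) set \<Rightarrow> ('a \<Rightarrow> complex) \<Rightarrow> bool"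
  where "is_zonal_spherical A G \<rho> W \<omega> \<longleftrightarrow>
    gelfand_pair (semidirect_product A G \<rho>) (embedded_factor A G) \<and>
    subrepresentation (semidirect_product A G \<rho>) W (functions_on (carrier A))
      (affine_representation A G \<rho>) \<and>
    spherical_representation (semidirect_product A G \<rho>) (embedded_factor A G) W
      (affine_representation A G \<rho>) \<and>
    \<omega> \<in> W \<and> (\<forall>g\<in>carrier G. \<forall>a\<in>carrier A. \<omega> (\<rho> g a) = \<omega> a) \<and> \<omega> \<one>\<^bsub>A\<^esub> = 1"

definition zonal_spherical_function :: "('a, 'm) monoid_scheme \<Rightarrow> ('g, 'n) monoid_scheme
    \<Rightarrow> ('g \<Rightarrow> 'a \<Rightarrow> 'a) \<Rightarrow> ('a \<Rightarrow> complex) set \<Rightarrow> 'a \<Rightarrow> complex"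
  where "zonal_spherical_function A G \<rho> W = (THE \<omega>. is_zonal_spherical A G \<rho> W \<omega>)"


section \<open>Characters and the canonical matrix\<close>

definition complex_units :: "complex monoid"
  where "complex_units = \<lparr>carrier = - {0}, mult = (*), one = 1\<rparr>"

definition characters :: "('a, 'm) monoid_scheme \<Rightarrow> ('a \<Rightarrow> complex) set"
  where "characters A = hom A complex_units \<inter> functions_on (carrier A)"

definition dual_action :: "('a, 'm) monoid_scheme \<Rightarrow> ('g, 'n) monoid_scheme
    \<Rightarrow> ('g \<Rightarrow> 'a \<Rightarrow> 'a) \<Rightarrow> 'g \<Rightarrow> ('a \<Rightarrow> complex) \<Rightarrow> 'a \<Rightarrow> complex"
  where "dual_action A G \<rho> = translate G (carrier A) \<rho>"

text \<open>The value of a function that is constant on the nonempty set \<open>S\<close>, such as an orbit.\<close>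

definition common_value :: "('x \<Rightarrow> complex) \<Rightarrow> 'x set \<Rightarrow> complex"
  where "common_value f S = (THE c. \<forall>x\<in>S. f x = c)"

definition canonical_matrix :: "('a \<Rightarrow> complex) set \<Rightarrow> 'a set \<Rightarrow> complex"
  where "canonical_matrix P Orb = common_value (\<lambda>\<xi>. \<Sum>a\<in>Orb. cnj (\<xi> a)) P"

end

theory Submission
  imports Defs "HOL-Algebra.Multiplicative_Group"
begin

text \<open>
  Averaging over a cyclic group with roots of unity as weights, one commuting element at a time,
  produces in every nonzero representation of \<open>A \<rtimes> G\<close> a joint eigenvector \<open>w\<close> of \<open>A\<close>. In an
  irreducible representation the vectors \<open>g w\<close>, for \<open>g \<in> G\<close>, therefore span, and the
  \<open>G\<close>-fixed vectors are the multiples of \<open>\<Sum>g\<in>G. g w\<close>: the pair is a Gelfand pair. A joint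
  eigenvector in \<open>\<complex>[A]\<close> is a multiple of a character, and by orthogonality the only characters
  in the span of an orbit \<open>P\<close> are those of \<open>P\<close>; hence that span is irreducible. Its
  zonal spherical function is the mean over \<open>h \<in> G\<close> of \<open>\<xi> \<circ> \<rho> h\<close>, which at \<open>a\<close> is the
  mean of \<open>\<xi>\<close> over the orbit of \<open>a\<close>.
\<close>

section \<open>Eigenvectors in representations of finite groups\<close>

lemma rep_subspace: "representation K V R \<Longrightarrow> cfun.subspace V"
  and rep_closed: "representation K V R \<Longrightarrow> k \<in> carrier K \<Longrightarrow> v \<in> V \<Longrightarrow> R k v \<in> V"
  and rep_add:
    "representation K V R \<Longrightarrow> k \<in> carrier K \<Longrightarrow> v \<in> V \<Longrightarrow> w \<in> V \<Longrightarrow> R k (v + w) = R k v + R k w"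
  and rep_scale:
    "representation K V R \<Longrightarrow> k \<in> carrier K \<Longrightarrow> v \<in> V \<Longrightarrow> R k (scale_fun c v) = scale_fun c (R k v)"
  and rep_one: "representation K V R \<Longrightarrow> v \<in> V \<Longrightarrow> R \<one>\<^bsub>K\<^esub> v = v"
  and rep_mult:
    "representation K V R \<Longrightarrow> k \<in> carrier K \<Longrightarrow> l \<in> carrier K \<Longrightarrow> v \<in> V
      \<Longrightarrow> R (k \<otimes>\<^bsub>K\<^esub> l) v = R k (R l v)"
  unfolding representation_def by blast+

lemma rep_zero:
  assumes "representation K V R" "k \<in> carrier K"
  shows "R k 0 = 0"
  using rep_scale[OF assms cfun.subspace_0[OF rep_subspace[OF assms(1)]], of 0]
  by simp

lemma rep_sum:
  assumes "representation K V R" "k \<in> carrier K" "\<And>i. i \<in> I \<Longrightarrow> f i \<in> V"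
  shows "R k (\<Sum>i\<in>I. f i) = (\<Sum>i\<in>I. R k (f i))"
  using assms(3)
proof (induction I rule: infinite_finite_induct)
  case (insert i I)
  have "(\<Sum>i\<in>I. f i) \<in> V"
    using insert.prems by (intro cfun.subspace_sum rep_subspace[OF assms(1)]) auto
  then have "R k (f i + (\<Sum>i\<in>I. f i)) = R k (f i) + R k (\<Sum>i\<in>I. f i)"
    using insert.prems by (intro rep_add[OF assms(1,2)]) auto
  moreover have "R k (\<Sum>i\<in>I. f i) = (\<Sum>i\<in>I. R k (f i))"
    using insert by blast
  ultimately show ?case by (simp only: sum.insert[OF insert.hyps])
qed (auto simp: rep_zero[OF assms(1,2)])

text \<open>The clause of \<open>representation\<close> that does not simply restrict to
  \<open>W\<close> is the finite spanning set: a basis of \<open>W\<close> is an independent subset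
  of the span of a finite set, hence finite.\<close>

lemma subrepresentation_imp_representation:
  assumes "subrepresentation K W V R"
  shows "representation K W R"
proof -
  have rep: "representation K V R" and WV: "W \<subseteq> V" and W: "cfun.subspace W"
    and inv: "\<forall>k\<in>carrier K. \<forall>w\<in>W. R k w \<in> W"
    using assms by (auto simp: subrepresentation_def)
  obtain B where B: "finite B" "V = cfun.span B"
    using rep by (auto simp: representation_def)
  obtain C where C: "C \<subseteq> W" "cfun.independent C" "W \<subseteq> cfun.span C"
    using cfun.basis_exists[of W] by metis
  have "finite C"
    using cfun.independent_span_bound[OF B(1) C(2)] C(1) WV B(2) by auto
  moreover have "W = cfun.span C"
    using C W by (simp add: cfun.span_minimal subset_antisym)
  ultimately have fin: "\<exists>C. finite C \<and> W = cfun.span C" by blast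
  have V: "w \<in> V" if "w \<in> W" for w using that WV by blast
  show ?thesis
    unfolding representation_def
    by (intro conjI ballI allI W fin inv[rule_format] rep_add[OF rep] rep_scale[OF rep]
        rep_one[OF rep] rep_mult[OF rep] V)
qed

text \<open>There are fewer \<open>k\<close>-th than \<open>n\<close>-th roots of unity, so some
  \<open>w\<close> has \<open>w ^ n = 1\<close> but \<open>w ^ k \<noteq> 1\<close>. Multiplication
  by \<open>w\<close> permutes the \<open>n\<close>-th roots and multiplies the sum by
  \<open>w ^ k\<close>, so the sum vanishes.\<close>

lemma sum_powers_roots_unity:
  fixes k n :: nat
  assumes "0 < k" "k < n"
  shows "(\<Sum>z | z ^ n = 1. z ^ k) = (0 :: complex)"
proof -
  have "card {z::complex. z ^ k = 1} < card {z::complex. z ^ n = 1}"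
    using assms by (simp add: card_roots_unity_eq)
  moreover have "finite {z::complex. z ^ k = 1}"
    using assms by (intro finite_roots_unity) auto
  ultimately have "\<not> {z::complex. z ^ n = 1} \<subseteq> {z. z ^ k = 1}"
    by (meson card_mono not_le)
  then obtain w :: complex where w: "w ^ n = 1" "w ^ k \<noteq> 1" by auto
  have w0: "w \<noteq> 0" using w assms by (cases n) auto
  have "(\<Sum>z | z ^ n = 1. z ^ k) = (\<Sum>z | z ^ n = 1. (w * z) ^ k)"
    by (rule sum.reindex_bij_witness[where i = "\<lambda>z. w * z" and j = "\<lambda>z. z / w"])
       (use w w0 in \<open>auto simp: power_mult_distrib power_divide\<close>)
  also have "\<dots> = w ^ k * (\<Sum>z | z ^ n = 1. z ^ k)"
    by (simp add: power_mult_distrib sum_distrib_left)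
  finally show ?thesis using w(2) by simp
qed

text \<open>Up to the factor \<open>n\<close>, these sums are the projections of \<open>w\<close> to
  the eigenspaces of \<open>a\<close>. Over all \<open>n\<close>-th roots of unity \<open>z\<close>
  they add up to \<open>n\<close> times \<open>w\<close>, so at least one is nonzero.\<close>

lemma eigenvector_average:
  assumes "group K" and rep: "representation K V R" and a: "a \<in> carrier K"
    and n: "n > 0" "a [^]\<^bsub>K\<^esub> n = \<one>\<^bsub>K\<^esub>" and w: "w \<in> V" "w \<noteq> 0"
  obtains z where "z ^ n = 1"
    and "(\<Sum>k<n. scale_fun (z ^ k) (R (a [^]\<^bsub>K\<^esub> k) w)) \<noteq> 0"
    and "R a (\<Sum>k<n. scale_fun (z ^ k) (R (a [^]\<^bsub>K\<^esub> k) w))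
      = scale_fun (inverse z) (\<Sum>k<n. scale_fun (z ^ k) (R (a [^]\<^bsub>K\<^esub> k) w))"
proof -
  interpret K: group K by fact
  define u where "u z = (\<Sum>k<n. scale_fun (z ^ k) (R (a [^]\<^bsub>K\<^esub> k) w))" for z
  note sub = rep_subspace[OF rep]
  have Rw: "R (a [^]\<^bsub>K\<^esub> k) w \<in> V" for k :: nat
    using a w by (simp add: rep_closed[OF rep])
  have "(\<Sum>z | z ^ n = 1. u z) = (\<Sum>k<n. scale_fun (\<Sum>z | z ^ n = 1. z ^ k) (R (a [^]\<^bsub>K\<^esub> k) w))"
    unfolding u_def by (subst sum.swap) (simp add: cfun.scale_sum_left)
  \<comment> \<open>Each power sum with \<open>0 < k < n\<close> vanishes; at \<open>k = 0\<close>
    it counts the \<open>n\<close> roots.\<close>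
  also have "\<dots> = (\<Sum>k<n. if k = 0 then scale_fun (of_nat n) w else 0)"
    using n w by (intro sum.cong refl)
      (auto simp: sum_powers_roots_unity card_roots_unity_eq rep_one[OF rep])
  also have "\<dots> = scale_fun (of_nat n) w" using n by simp
  finally have "(\<Sum>z | z ^ n = 1. u z) \<noteq> 0"
    using n w by simp
  then obtain z where z: "z ^ n = 1" "u z \<noteq> 0"
    by (metis (mono_tags, lifting) mem_Collect_eq sum.neutral)
  have z0: "z \<noteq> 0" using z n by (cases n) auto
  define f where "f k = scale_fun (z ^ k) (R (a [^]\<^bsub>K\<^esub> k) w)" for k :: nat
  have "R a (u z) = (\<Sum>k<n. scale_fun (z ^ k) (R a (R (a [^]\<^bsub>K\<^esub> k) w)))"
    unfolding u_def using Rw a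
    by (simp add: rep_sum[OF rep] rep_scale[OF rep] cfun.subspace_scale[OF sub])
  also have "\<dots> = (\<Sum>k<n. scale_fun (inverse z) (f (Suc k)))"
  proof (intro sum.cong refl)
    fix k
    have "R a (R (a [^]\<^bsub>K\<^esub> k) w) = R (a [^]\<^bsub>K\<^esub> Suc k) w"
      using a w by (simp only: K.nat_pow_Suc2 rep_mult[OF rep] K.nat_pow_closed)
    then show "scale_fun (z ^ k) (R a (R (a [^]\<^bsub>K\<^esub> k) w)) = scale_fun (inverse z) (f (Suc k))"
      using z0 by (simp add: f_def)
  qed
  also have "\<dots> = scale_fun (inverse z) (\<Sum>k<n. f (Suc k))"
    by (simp add: cfun.scale_sum_right)
  \<comment> \<open>The shift is cyclic: \<open>z ^ n = 1\<close> and the \<open>n\<close>-th power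
    of \<open>a\<close> being trivial give \<open>f n = f 0\<close>.\<close>
  also have "(\<Sum>k<n. f (Suc k)) = (\<Sum>k<n. f k)"
  proof -
    have "f n = f 0" using z n by (simp add: f_def)
    then show ?thesis
      using sum.lessThan_Suc_shift[of f n] sum.lessThan_Suc[of f n] by (simp add: add.commute)
  qed
  also have "\<dots> = u z" by (simp add: u_def f_def)
  finally show ?thesis using that z unfolding u_def by blast
qed

text \<open>Induction on \<open>S\<close>: the averages over the powers of a new element
  \<open>a\<close> remain eigenvectors, with the same eigenvalues, of all earlier elements, because
  these commute with the powers of \<open>a\<close>.\<close>

lemma joint_eigenvector:
  assumes "group K" "finite (carrier K)" and rep: "representation K V R" and "V \<noteq> {0}"
    and "finite S" "S \<subseteq> carrier K"
    and comm: "\<And>a b. a \<in> S \<Longrightarrow> b \<in> S \<Longrightarrow> a \<otimes>\<^bsub>K\<^esub> b = b \<otimes>\<^bsub>K\<^esub> a"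
  obtains w where "w \<in> V" "w \<noteq> 0" "\<And>a. a \<in> S \<Longrightarrow> \<exists>c. R a w = scale_fun c w"
proof -
  interpret K: group K by fact
  note sub = rep_subspace[OF rep]
  have "\<exists>w\<in>V. w \<noteq> 0 \<and> (\<forall>a\<in>S. \<exists>c. R a w = scale_fun c w)"
    using assms(5,6) comm
  proof (induction S)
    case empty
    then show ?case using \<open>V \<noteq> {0}\<close> cfun.subspace_0[OF sub] by blast
  next
    case (insert a S)
    then obtain w where w: "w \<in> V" "w \<noteq> 0" "\<forall>b\<in>S. \<exists>c. R b w = scale_fun c w"
      by (metis insertCI insert_subset)
    have a: "a \<in> carrier K" using insert.prems by simp
    \<comment> \<open>The group order is an exponent that kills every element, so it serves for each
      \<open>a\<close>.\<close>
    have n: "order K > 0" "a [^]\<^bsub>K\<^esub> order K = \<one>\<^bsub>K\<^esub>"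
      using assms(2) a K.order_gt_0_iff_finite K.pow_order_eq_1 by auto
    obtain z where z: "(\<Sum>k<order K. scale_fun (z ^ k) (R (a [^]\<^bsub>K\<^esub> k) w)) \<noteq> 0"
      "R a (\<Sum>k<order K. scale_fun (z ^ k) (R (a [^]\<^bsub>K\<^esub> k) w))
      = scale_fun (inverse z) (\<Sum>k<order K. scale_fun (z ^ k) (R (a [^]\<^bsub>K\<^esub> k) w))"
      by (rule eigenvector_average[OF assms(1) rep a n w(1,2)])
    define u where "u = (\<Sum>k<order K. scale_fun (z ^ k) (R (a [^]\<^bsub>K\<^esub> k) w))"
    have Rw: "R (a [^]\<^bsub>K\<^esub> k) w \<in> V" for k :: nat
      using a w by (simp add: rep_closed[OF rep])
    have "u \<in> V"
      unfolding u_def by (intro cfun.subspace_sum[OF sub] cfun.subspace_scale[OF sub] Rw)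
    moreover have "\<exists>c. R b u = scale_fun c u" if b: "b \<in> S" for b
    proof -
      obtain c where c: "R b w = scale_fun c w" using w(3) b by blast
      have bK: "b \<in> carrier K" using b insert.prems by blast
      have comm: "b \<otimes>\<^bsub>K\<^esub> a [^]\<^bsub>K\<^esub> k = a [^]\<^bsub>K\<^esub> k \<otimes>\<^bsub>K\<^esub> b" for k :: nat
        using insert.prems(2)[of a b] b by (simp add: K.group_commutes_pow[OF _ a bK])
      have "R b (R (a [^]\<^bsub>K\<^esub> k) w) = scale_fun c (R (a [^]\<^bsub>K\<^esub> k) w)" for k :: nat
      proof -
        have "R b (R (a [^]\<^bsub>K\<^esub> k) w) = R (a [^]\<^bsub>K\<^esub> k) (R b w)"
          using bK a w(1) comm[of k] by (metis rep_mult[OF rep] K.nat_pow_closed)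
        then show ?thesis using a w(1) by (simp add: c rep_scale[OF rep])
      qed
      then have "R b u = scale_fun c u"
        unfolding u_def using bK Rw
        by (simp add: rep_sum[OF rep] rep_scale[OF rep]
            cfun.subspace_scale[OF sub] cfun.scale_sum_right mult.commute)
      then show ?thesis ..
    qed
    ultimately show ?case using z unfolding u_def[symmetric] by blast
  qed
  then show ?thesis using that by blast
qed

section \<open>The pair \<open>(A \<rtimes> G, G)\<close>\<close>

locale automorphism_action =
  A: comm_group A + G: group G for A :: "('a, 'm) monoid_scheme" and G :: "('g, 'n) monoid_scheme" +
  fixes \<rho> :: "'g \<Rightarrow> 'a \<Rightarrow> 'a"
  assumes finite_A: "finite (carrier A)" and finite_G: "finite (carrier G)"
    and \<rho>: "\<rho> \<in> hom G (AutoGroup A)"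
begin

abbreviation "K \<equiv> semidirect_product A G \<rho>"
abbreviation "T \<equiv> affine_representation A G \<rho>"

lemma action_auto: "g \<in> carrier G \<Longrightarrow> \<rho> g \<in> auto A"
  using hom_in_carrier[OF \<rho>] by (simp add: AutoGroup_def)

lemma action_hom: "g \<in> carrier G \<Longrightarrow> \<rho> g \<in> hom A A"
  and action_Bij: "g \<in> carrier G \<Longrightarrow> \<rho> g \<in> Bij (carrier A)"
  using action_auto[of g] by (simp_all add: auto_def)

lemma action_bij: "g \<in> carrier G \<Longrightarrow> bij_betw (\<rho> g) (carrier A) (carrier A)"
  using action_Bij[of g] by (simp add: Bij_def)

lemma action_closed [simp]: "g \<in> carrier G \<Longrightarrow> a \<in> carrier A \<Longrightarrow> \<rho> g a \<in> carrier A"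
  by (rule hom_in_carrier[OF action_hom])

lemma action_mult [simp]:
  "g \<in> carrier G \<Longrightarrow> a \<in> carrier A \<Longrightarrow> b \<in> carrier A \<Longrightarrow> \<rho> g (a \<otimes>\<^bsub>A\<^esub> b) = \<rho> g a \<otimes>\<^bsub>A\<^esub> \<rho> g b"
  by (rule hom_mult[OF action_hom])

lemma action_comp:
  assumes "g \<in> carrier G" "h \<in> carrier G" "a \<in> carrier A"
  shows "\<rho> (g \<otimes>\<^bsub>G\<^esub> h) a = \<rho> g (\<rho> h a)"
proof -
  have "\<rho> (g \<otimes>\<^bsub>G\<^esub> h) = compose (carrier A) (\<rho> g) (\<rho> h)"
    using hom_mult[OF \<rho> assms(1,2)] action_Bij[OF assms(1)] action_Bij[OF assms(2)]
    by (simp add: AutoGroup_def BijGroup_def)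
  then show ?thesis using assms(3) by (simp add: compose_eq)
qed

text \<open>An idempotent injective map is the identity.\<close>

lemma action_one [simp]: "a \<in> carrier A \<Longrightarrow> \<rho> \<one>\<^bsub>G\<^esub> a = a"
  using action_comp[of "\<one>\<^bsub>G\<^esub>" "\<one>\<^bsub>G\<^esub>" a] action_bij[of "\<one>\<^bsub>G\<^esub>"]
  by (simp add: bij_betw_def inj_on_def)

lemma action_fixes_one [simp]: "g \<in> carrier G \<Longrightarrow> \<rho> g \<one>\<^bsub>A\<^esub> = \<one>\<^bsub>A\<^esub>"
  by (rule hom_one[OF action_hom]) (auto intro: A.is_group)

lemma action_inv: "g \<in> carrier G \<Longrightarrow> a \<in> carrier A \<Longrightarrow> \<rho> g (inv\<^bsub>A\<^esub> a) = inv\<^bsub>A\<^esub> (\<rho> g a)"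
  by (metis A.inv_equality A.l_inv A.inv_closed action_closed action_fixes_one action_mult)

lemma action_cancel [simp]:
  "g \<in> carrier G \<Longrightarrow> a \<in> carrier A \<Longrightarrow> \<rho> (inv\<^bsub>G\<^esub> g) (\<rho> g a) = a"
  "g \<in> carrier G \<Longrightarrow> a \<in> carrier A \<Longrightarrow> \<rho> g (\<rho> (inv\<^bsub>G\<^esub> g) a) = a"
  by (simp_all flip: action_comp)

lemma semidirect_simps:
  "carrier K = carrier A \<times> carrier G"
  "(a, g) \<otimes>\<^bsub>K\<^esub> (b, h) = (a \<otimes>\<^bsub>A\<^esub> \<rho> g b, g \<otimes>\<^bsub>G\<^esub> h)"
  "\<one>\<^bsub>K\<^esub> = (\<one>\<^bsub>A\<^esub>, \<one>\<^bsub>G\<^esub>)"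
  by (simp_all add: semidirect_product_def)

lemma semidirect_group: "group K"
proof (rule groupI)
  fix x assume "x \<in> carrier K"
  then obtain a g where x: "x = (a, g)" "a \<in> carrier A" "g \<in> carrier G"
    by (auto simp: semidirect_simps)
  then show "\<exists>y\<in>carrier K. y \<otimes>\<^bsub>K\<^esub> x = \<one>\<^bsub>K\<^esub>"
    \<comment> \<open>The witness solves \<open>(b, h) \<otimes> (a, g) = \<one>\<close>: first
      \<open>h\<close> is the inverse of \<open>g\<close>, then \<open>b\<close> is the inverse of
      \<open>\<rho> h a\<close>.\<close>
    by (intro bexI[of _ "(inv\<^bsub>A\<^esub> (\<rho> (inv\<^bsub>G\<^esub> g) a), inv\<^bsub>G\<^esub> g)"]) (auto simp: semidirect_simps)
qed (auto simp: semidirect_simps A.m_assoc G.m_assoc action_comp)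

lemma semidirect_inv:
  assumes "a \<in> carrier A" "g \<in> carrier G"
  shows "inv\<^bsub>K\<^esub> (a, g) = (\<rho> (inv\<^bsub>G\<^esub> g) (inv\<^bsub>A\<^esub> a), inv\<^bsub>G\<^esub> g)"
  by (rule group.inv_equality[OF semidirect_group])
     (use assms in \<open>auto simp: semidirect_simps simp flip: action_mult\<close>)

lemma semidirect_finite: "finite (carrier K)"
  using finite_A finite_G by (simp add: semidirect_simps)

lemma embedded_factor_subgroup: "subgroup (embedded_factor A G) K"
  by unfold_locales (auto simp: embedded_factor_def semidirect_simps semidirect_inv)

section \<open>Joint eigenvectors of the normal subgroup and the Gelfand property\<close>

text \<open>The translates of \<open>w\<close> by \<open>G\<close> are again joint eigenvectors of
  \<open>A\<close>, with eigenvalues twisted by the action. An element \<open>(a, h)\<close> thus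
  permutes the generators up to scalars.\<close>

lemma orbit_span_affine_invariant:
  assumes rep: "representation K V R" and w: "w \<in> V"
    and eig: "\<And>a. a \<in> carrier A \<Longrightarrow> \<exists>c. R (a, \<one>\<^bsub>G\<^esub>) w = scale_fun c w"
  shows "subrepresentation K (cfun.span ((\<lambda>g. R (\<one>\<^bsub>A\<^esub>, g) w) ` carrier G)) V R"
proof -
  define B where "B = (\<lambda>g. R (\<one>\<^bsub>A\<^esub>, g) w) ` carrier G"
  note sub = rep_subspace[OF rep]
  have BV: "B \<subseteq> V"
    using w by (auto simp: B_def semidirect_simps intro!: rep_closed[OF rep])
  have WV: "cfun.span B \<subseteq> V"
    by (rule cfun.span_minimal[OF BV sub])
  have "R k v \<in> cfun.span B" if k: "k \<in> carrier K" and "v \<in> cfun.span B" for k v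
  proof -
    obtain a h where ah: "k = (a, h)" "a \<in> carrier A" "h \<in> carrier G"
      using k by (auto simp: semidirect_simps)
    \<comment> \<open>Membership in \<open>V\<close> is carried through the induction because
      \<open>R k\<close> is linear only on \<open>V\<close>.\<close>
    have "v \<in> V \<and> R k v \<in> cfun.span B" using that(2)
    proof (induction rule: cfun.span_induct_alt)
      case base
      show ?case by (simp only: rep_zero[OF rep k] cfun.span_zero cfun.subspace_0[OF sub])
    next
      case (step c x y)
      then obtain g where g: "g \<in> carrier G" "x = R (\<one>\<^bsub>A\<^esub>, g) w" by (auto simp: B_def)
      \<comment> \<open>\<open>b\<close> is what \<open>a\<close> becomes when moved to the right
        past \<open>h \<otimes> g\<close>, where it acts on \<open>w\<close> by a scalar.\<close>
      define b where "b = \<rho> (inv\<^bsub>G\<^esub> (h \<otimes>\<^bsub>G\<^esub> g)) a"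
      have b: "b \<in> carrier A" using ah g by (simp add: b_def)
      obtain d where d: "R (b, \<one>\<^bsub>G\<^esub>) w = scale_fun d w" using eig[OF b] by blast
      have "R k x = R (k \<otimes>\<^bsub>K\<^esub> (\<one>\<^bsub>A\<^esub>, g)) w"
        using k g w by (simp add: rep_mult[OF rep] semidirect_simps)
      also have "k \<otimes>\<^bsub>K\<^esub> (\<one>\<^bsub>A\<^esub>, g) = (\<one>\<^bsub>A\<^esub>, h \<otimes>\<^bsub>G\<^esub> g) \<otimes>\<^bsub>K\<^esub> (b, \<one>\<^bsub>G\<^esub>)"
        using ah g by (simp add: semidirect_simps b_def del: G.inv_mult_group)
      also have "R \<dots> w = scale_fun d (R (\<one>\<^bsub>A\<^esub>, h \<otimes>\<^bsub>G\<^esub> g) w)"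
        using ah g w b d
        by (subst rep_mult[OF rep])
           (simp_all add: semidirect_simps rep_scale[OF rep])
      finally have "R k x = scale_fun d (R (\<one>\<^bsub>A\<^esub>, h \<otimes>\<^bsub>G\<^esub> g) w)" .
      moreover have "R (\<one>\<^bsub>A\<^esub>, h \<otimes>\<^bsub>G\<^esub> g) w \<in> B"
        using ah g by (auto simp: B_def)
      ultimately have "R k x \<in> cfun.span B"
        by (simp only: cfun.span_scale cfun.span_base)
      moreover have "R k (scale_fun c x + y) = scale_fun c (R k x) + R k y"
      proof -
        have x: "x \<in> V" using step(1) BV by blast
        have y: "y \<in> V" using step.IH by blast
        show ?thesis
          using k x y cfun.subspace_scale[OF sub x]
          by (simp only: rep_add[OF rep] rep_scale[OF rep])
      qed
      moreover have "scale_fun c x + y \<in> V"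
        using step(1,2) BV by (blast intro: cfun.subspace_add[OF sub] cfun.subspace_scale[OF sub])
      ultimately show ?case
        using step by (simp only: cfun.span_add cfun.span_scale)
    qed
    then show ?thesis ..
  qed
  then show ?thesis
    using rep WV by (auto simp: subrepresentation_def cfun.subspace_span simp flip: B_def)
qed

text \<open>Summing over \<open>G\<close> (the operator \<open>M\<close>) sends every generator to
  the same vector \<open>s\<close>, since right multiplication permutes \<open>G\<close>; hence
  \<open>M\<close> maps \<open>V\<close> into the line through \<open>s\<close>. On a fixed vector
  \<open>M\<close> is multiplication by the order of \<open>G\<close>, so the vector itself lies in
  that line.\<close>

lemma fixed_vectors_in_span:
  assumes rep: "representation K V R" and w: "w \<in> V"
    and V: "V \<subseteq> cfun.span ((\<lambda>g. R (\<one>\<^bsub>A\<^esub>, g) w) ` carrier G)"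
  shows "fixed_vectors (embedded_factor A G) V R
    \<subseteq> cfun.span {\<Sum>h\<in>carrier G. R (\<one>\<^bsub>A\<^esub>, h) w}"
proof
  define s where "s = (\<Sum>h\<in>carrier G. R (\<one>\<^bsub>A\<^esub>, h) w)"
  define B where "B = (\<lambda>g. R (\<one>\<^bsub>A\<^esub>, g) w) ` carrier G"
  define M where "M v = (\<Sum>h\<in>carrier G. R (\<one>\<^bsub>A\<^esub>, h) v)" for v
  note sub = rep_subspace[OF rep]
  have G: "(\<one>\<^bsub>A\<^esub>, h) \<in> carrier K" if "h \<in> carrier G" for h
    using that by (simp add: semidirect_simps)
  have BV: "B \<subseteq> V"
    using w G by (auto simp: B_def intro!: rep_closed[OF rep])
  have M: "v \<in> V \<and> M v \<in> cfun.span {s}" if "v \<in> cfun.span B" for v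
    using that
  proof (induction rule: cfun.span_induct_alt)
    case base
    have "M 0 = 0" unfolding M_def by (rule sum.neutral) (use G in \<open>auto simp only: rep_zero[OF rep]\<close>)
    then show ?case by (simp only: cfun.span_zero cfun.subspace_0[OF sub])
  next
    case (step c x y)
    then obtain g where g: "g \<in> carrier G" "x = R (\<one>\<^bsub>A\<^esub>, g) w" by (auto simp: B_def)
    have x: "x \<in> V" using step(1) BV by blast
    have "M x = (\<Sum>h\<in>carrier G. R (\<one>\<^bsub>A\<^esub>, h \<otimes>\<^bsub>G\<^esub> g) w)"
      unfolding M_def g(2)
      by (intro sum.cong refl)
         (use g w G in \<open>simp add: semidirect_simps flip: rep_mult[OF rep]\<close>)
    also have "\<dots> = s"
      unfolding s_def
      by (rule sum.reindex_bij_witness[where i = "\<lambda>h. h \<otimes>\<^bsub>G\<^esub> inv\<^bsub>G\<^esub> g" and j = "\<lambda>h. h \<otimes>\<^bsub>G\<^esub> g"])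
         (use g in \<open>auto simp: G.m_assoc\<close>)
    finally have Mx: "M x = s" .
    have "M (scale_fun c x + y) = scale_fun c (M x) + M y"
    proof -
      have "R (\<one>\<^bsub>A\<^esub>, h) (scale_fun c x + y) = scale_fun c (R (\<one>\<^bsub>A\<^esub>, h) x) + R (\<one>\<^bsub>A\<^esub>, h) y"
        if "h \<in> carrier G" for h
        using G[OF that] x step cfun.subspace_scale[OF sub x]
        by (simp only: rep_add[OF rep] rep_scale[OF rep])
      then show ?thesis
        unfolding M_def by (simp only: sum.distrib cfun.scale_sum_right cong: sum.cong)
    qed
    moreover have "scale_fun c x + y \<in> V"
      using x step by (simp only: cfun.subspace_add[OF sub] cfun.subspace_scale[OF sub])
    ultimately show ?case
      using step Mx by (simp only: cfun.span_add cfun.span_scale cfun.span_base singletonI)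
  qed
  fix v assume "v \<in> fixed_vectors (embedded_factor A G) V R"
  then have v: "v \<in> V" and fixed: "\<And>h. h \<in> carrier G \<Longrightarrow> R (\<one>\<^bsub>A\<^esub>, h) v = v"
    by (auto simp: fixed_vectors_def embedded_factor_def)
  have "M v = scale_fun (of_nat (order G)) v"
    unfolding M_def by (simp add: fixed order_def cfun.scale_left_distrib fun_eq_iff scale_fun_def)
  then have "v = scale_fun (inverse (of_nat (order G))) (M v)"
    using finite_G G.order_gt_0_iff_finite by simp
  moreover have "M v \<in> cfun.span {s}"
    using M[of v] v V by (auto simp: B_def)
  ultimately show "v \<in> cfun.span {s}"
    by (metis cfun.span_scale)
qed

text \<open>By irreducibility the \<open>G\<close>-translates of a joint eigenvector of
  \<open>A\<close> span the whole space, which confines the fixed vectors to the span of a single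
  vector.\<close>

lemma semidirect_gelfand_pair: "gelfand_pair K (embedded_factor A G)"
proof -
  have "cfun.dim (fixed_vectors (embedded_factor A G) V R) \<le> 1"
    if irr: "irreducible_representation K V R" for V :: "(nat \<Rightarrow> complex) set" and R
  proof -
    have rep: "representation K V R" and V0: "V \<noteq> {0}"
      and irr: "\<And>W. subrepresentation K W V R \<Longrightarrow> W = {0} \<or> W = V"
      using that by (auto simp: irreducible_representation_def)
    obtain w where w: "w \<in> V" "w \<noteq> 0"
      and eig: "\<And>x. x \<in> carrier A \<times> {\<one>\<^bsub>G\<^esub>} \<Longrightarrow> \<exists>c. R x w = scale_fun c w"
      by (rule joint_eigenvector[OF semidirect_group semidirect_finite rep V0,
            of "carrier A \<times> {\<one>\<^bsub>G\<^esub>}"])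
         (use finite_A in \<open>auto simp: semidirect_simps A.m_comm\<close>)
    define B where "B = (\<lambda>g. R (\<one>\<^bsub>A\<^esub>, g) w) ` carrier G"
    have "subrepresentation K (cfun.span B) V R"
      unfolding B_def using eig by (intro orbit_span_affine_invariant[OF rep w(1)]) auto
    moreover have "w \<in> cfun.span B"
      using rep_one[OF rep w(1)] by (intro cfun.span_base) (force simp: B_def semidirect_simps)
    ultimately have "V = cfun.span B" using irr w(2) by blast
    then have "fixed_vectors (embedded_factor A G) V R
        \<subseteq> cfun.span {\<Sum>h\<in>carrier G. R (\<one>\<^bsub>A\<^esub>, h) w}"
      by (intro fixed_vectors_in_span[OF rep w(1)]) (simp add: B_def)
    \<comment> \<open>A one-element spanning set bounds the dimension by 1 even if its element is
      0.\<close>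
    from cfun.dim_le_card[OF this] show ?thesis by simp
  qed
  then show ?thesis
    by (simp add: gelfand_pair_def semidirect_group semidirect_finite embedded_factor_subgroup)
qed

section \<open>The representation on functions on \<open>A\<close>\<close>

text \<open>In additive notation, the inverse of \<open>x \<mapsto> b + \<rho> g x\<close> is
  \<open>x \<mapsto> \<rho> (inv g) (x - b)\<close>.\<close>

lemma affine_representation_apply:
  assumes "b \<in> carrier A" "g \<in> carrier G"
  shows "T (b, g) f x
    = (if x \<in> carrier A then f (\<rho> (inv\<^bsub>G\<^esub> g) (inv\<^bsub>A\<^esub> b \<otimes>\<^bsub>A\<^esub> x)) else 0)"
  using assms
  by (simp add: affine_representation_def translate_def affine_action_def semidirect_inv)

lemma dual_action_apply:
  "dual_action A G \<rho> g f x = (if x \<in> carrier A then f (\<rho> (inv\<^bsub>G\<^esub> g) x) else 0)"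
  by (simp add: dual_action_def translate_def)

text \<open>This makes a dual orbit the orbit of a vector under the factor \<open>G\<close>, so that
  \<open>orbit_span_affine_invariant\<close> and \<open>fixed_vectors_in_span\<close> apply to its
  span.\<close>

lemma affine_representation_factor:
  assumes "g \<in> carrier G"
  shows "T (\<one>\<^bsub>A\<^esub>, g) f = dual_action A G \<rho> g f"
  using assms by (auto simp: fun_eq_iff affine_representation_apply dual_action_apply)

text \<open>The point masses provide the finite spanning set demanded by
  \<open>representation\<close>.\<close>

lemma functions_on_span: "functions_on (carrier A) = cfun.span ((\<lambda>a x. of_bool (x = a)) ` carrier A)"
proof
  have sub: "cfun.subspace (functions_on (carrier A))"
    by (auto simp: cfun.subspace_def functions_on_def scale_fun_def)
  show "cfun.span ((\<lambda>a x. of_bool (x = a)) ` carrier A) \<subseteq> functions_on (carrier A)"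
    by (rule cfun.span_minimal[OF _ sub]) (auto simp: functions_on_def)
  show "functions_on (carrier A) \<subseteq> cfun.span ((\<lambda>a x. of_bool (x = a)) ` carrier A)"
  proof
    fix f assume f: "f \<in> functions_on (carrier A)"
    have "(\<Sum>a\<in>carrier A. scale_fun (f a) (\<lambda>x. of_bool (x = a)) x) = f x" for x
    proof -
      have "(\<Sum>a\<in>carrier A. scale_fun (f a) (\<lambda>x. of_bool (x = a)) x)
          = (\<Sum>a\<in>carrier A. if x = a then f a else 0)"
        by (intro sum.cong) (auto simp: scale_fun_def)
      then show ?thesis using f finite_A by (auto simp: functions_on_def)
    qed
    moreover have "sum h S x = (\<Sum>i\<in>S. h i x)" for h :: "'a \<Rightarrow> 'a \<Rightarrow> complex" and S x
      by (induction S rule: infinite_finite_induct) auto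
    ultimately have eq: "(\<Sum>a\<in>carrier A. scale_fun (f a) (\<lambda>x. of_bool (x = a))) = f"
      by (simp add: fun_eq_iff)
    have "(\<Sum>a\<in>carrier A. scale_fun (f a) (\<lambda>x. of_bool (x = a)))
        \<in> cfun.span ((\<lambda>a x. of_bool (x = a)) ` carrier A)"
      by (intro cfun.span_sum cfun.span_scale cfun.span_base imageI)
    then show "f \<in> cfun.span ((\<lambda>a x. of_bool (x = a)) ` carrier A)"
      by (simp only: eq)
  qed
qed

lemma affine_representation: "representation K (functions_on (carrier A)) T"
proof -
  have sub: "cfun.subspace (functions_on (carrier A))"
    by (auto simp: cfun.subspace_def functions_on_def scale_fun_def)
  have fin: "\<exists>B. finite B \<and> functions_on (carrier A) = cfun.span B"
    using functions_on_span finite_A by blast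
  have mult: "T (k \<otimes>\<^bsub>K\<^esub> l) v = T k (T l v)" if kl: "k \<in> carrier K" "l \<in> carrier K" for k l v
  proof
    fix x
    obtain a g b h where ab: "k = (a, g)" "l = (b, h)" "a \<in> carrier A" "b \<in> carrier A"
      "g \<in> carrier G" "h \<in> carrier G"
      using kl by (auto simp: semidirect_simps)
    show "T (k \<otimes>\<^bsub>K\<^esub> l) v x = T k (T l v) x"
    proof (cases "x \<in> carrier A")
      case True
      \<comment> \<open>The right side is kept in the form \<open>\<rho> g (...)\<close> so that the
        inverse of \<open>g\<close> from the inverse of \<open>k \<otimes> l\<close> cancels it;
        what remains is the composite of the two inverse affine maps.\<close>
      have "inv\<^bsub>A\<^esub> (a \<otimes>\<^bsub>A\<^esub> \<rho> g b) \<otimes>\<^bsub>A\<^esub> x = \<rho> g (inv\<^bsub>A\<^esub> b \<otimes>\<^bsub>A\<^esub> \<rho> (inv\<^bsub>G\<^esub> g) (inv\<^bsub>A\<^esub> a \<otimes>\<^bsub>A\<^esub> x))"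
        using ab True by (simp add: A.inv_mult action_inv A.m_ac flip: action_comp)
      then show ?thesis
        using ab True
        by (simp add: semidirect_simps affine_representation_apply G.inv_mult_group action_comp
            del: action_mult)
    qed (use ab in \<open>simp add: semidirect_simps affine_representation_apply\<close>)
  qed
  show ?thesis
    unfolding representation_def
    using sub fin mult
    by (auto simp: semidirect_simps affine_representation_apply fun_eq_iff functions_on_def
        scale_fun_def)
qed

section \<open>Characters and their orthogonality\<close>

lemma character_mult:
  "\<xi> \<in> characters A \<Longrightarrow> a \<in> carrier A \<Longrightarrow> b \<in> carrier A \<Longrightarrow> \<xi> (a \<otimes>\<^bsub>A\<^esub> b) = \<xi> a * \<xi> b"
  and character_nonzero: "\<xi> \<in> characters A \<Longrightarrow> a \<in> carrier A \<Longrightarrow> \<xi> a \<noteq> 0"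
  and character_outside: "\<xi> \<in> characters A \<Longrightarrow> a \<notin> carrier A \<Longrightarrow> \<xi> a = 0"
  by (auto simp: characters_def hom_def complex_units_def functions_on_def)

lemma character_one: "\<xi> \<in> characters A \<Longrightarrow> \<xi> \<one>\<^bsub>A\<^esub> = 1"
  using character_mult[of \<xi> "\<one>\<^bsub>A\<^esub>" "\<one>\<^bsub>A\<^esub>"] character_nonzero[of \<xi> "\<one>\<^bsub>A\<^esub>"] by simp

text \<open>Values in \<open>complex_units\<close> are automatic: the product of
  \<open>\<xi> a\<close> and the value at the inverse of \<open>a\<close> is 1.\<close>

lemma charactersI:
  assumes "\<And>a b. a \<in> carrier A \<Longrightarrow> b \<in> carrier A \<Longrightarrow> \<xi> (a \<otimes>\<^bsub>A\<^esub> b) = \<xi> a * \<xi> b"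
    and "\<xi> \<one>\<^bsub>A\<^esub> = 1" and "\<And>a. a \<notin> carrier A \<Longrightarrow> \<xi> a = 0"
  shows "\<xi> \<in> characters A"
proof -
  have "\<xi> a \<noteq> 0" if "a \<in> carrier A" for a
    using assms(1)[of a "inv\<^bsub>A\<^esub> a"] assms(2) that by auto
  then show ?thesis
    using assms by (auto simp: characters_def hom_def complex_units_def functions_on_def)
qed

lemma dual_action_character:
  assumes "\<xi> \<in> characters A" "g \<in> carrier G"
  shows "dual_action A G \<rho> g \<xi> \<in> characters A"
  using assms by (intro charactersI) (auto simp: dual_action_apply character_mult character_one)

text \<open>The inverse in the eigenvalue comes from \<open>translate\<close>, which precomposes
  with the inverse group element.\<close>

lemma character_eigenvector:
  assumes "\<xi> \<in> characters A" "a \<in> carrier A"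
  shows "T (a, \<one>\<^bsub>G\<^esub>) \<xi> = scale_fun (\<xi> (inv\<^bsub>A\<^esub> a)) \<xi>"
  using assms
  by (auto simp: fun_eq_iff affine_representation_apply character_mult scale_fun_def
      character_outside)

text \<open>The eigenvector equations say that \<open>f (a \<otimes> x) = c * f x\<close> with
  \<open>c\<close> depending on \<open>a\<close> only. Putting \<open>x = \<one>\<close> identifies
  \<open>c\<close> as \<open>f a / f \<one>\<close>, so \<open>f / f \<one>\<close> is
  multiplicative.\<close>

lemma eigenvector_character:
  assumes f: "f \<in> functions_on (carrier A)" "f \<noteq> 0"
    and eig: "\<And>a. a \<in> carrier A \<Longrightarrow> \<exists>c. T (a, \<one>\<^bsub>G\<^esub>) f = scale_fun c f"
  obtains c \<xi> where "c \<noteq> 0" "\<xi> \<in> characters A" "f = scale_fun c \<xi>"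
proof -
  have ex: "\<exists>c. \<forall>x\<in>carrier A. f (a \<otimes>\<^bsub>A\<^esub> x) = c * f x" if a: "a \<in> carrier A" for a
  proof -
    obtain c where c: "T (inv\<^bsub>A\<^esub> a, \<one>\<^bsub>G\<^esub>) f = scale_fun c f"
      using eig[of "inv\<^bsub>A\<^esub> a"] a by auto
    have "f (a \<otimes>\<^bsub>A\<^esub> x) = c * f x" if "x \<in> carrier A" for x
      using fun_cong[OF c, of x] that a by (simp add: affine_representation_apply scale_fun_def)
    then show ?thesis by blast
  qed
  \<comment> \<open>If \<open>f\<close> vanished at the identity, the equations at
    \<open>x = \<one>\<close> would make it vanish on all of \<open>A\<close>.\<close>
  have f1: "f \<one>\<^bsub>A\<^esub> \<noteq> 0"
  proof
    assume "f \<one>\<^bsub>A\<^esub> = 0"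
    then have "f a = 0" if "a \<in> carrier A" for a
      using ex[OF that] that
      by (metis A.one_closed A.r_one mult_zero_right)
    then show False using f by (auto simp: functions_on_def fun_eq_iff)
  qed
  define \<xi> where "\<xi> x = f x / f \<one>\<^bsub>A\<^esub>" for x
  have "\<xi> \<in> characters A"
  proof (rule charactersI)
    fix a b assume ab: "a \<in> carrier A" "b \<in> carrier A"
    obtain c where c: "\<forall>x\<in>carrier A. f (a \<otimes>\<^bsub>A\<^esub> x) = c * f x" using ex ab by blast
    have "f a = c * f \<one>\<^bsub>A\<^esub>" using c[rule_format, of "\<one>\<^bsub>A\<^esub>"] ab by simp
    then show "\<xi> (a \<otimes>\<^bsub>A\<^esub> b) = \<xi> a * \<xi> b"
      using c ab f1 by (simp add: \<xi>_def)
  qed (use f f1 in \<open>auto simp: \<xi>_def functions_on_def\<close>)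
  moreover have "f = scale_fun (f \<one>\<^bsub>A\<^esub>) \<xi>"
    using f1 by (simp add: \<xi>_def scale_fun_def fun_eq_iff)
  ultimately show ?thesis using that f1 by blast
qed

text \<open>The value at the inverse stands for the complex conjugate. If the characters differ at
  \<open>b\<close>, the substitution of \<open>b \<otimes> a\<close> for \<open>a\<close> multiplies
  the sum by a factor other than 1.\<close>

lemma character_orthogonality:
  assumes "\<chi> \<in> characters A" "\<xi> \<in> characters A" "\<chi> \<noteq> \<xi>"
  shows "(\<Sum>a\<in>carrier A. \<chi> a * \<xi> (inv\<^bsub>A\<^esub> a)) = 0"
proof -
  have inv: "\<xi> b * \<xi> (inv\<^bsub>A\<^esub> b) = 1" if "b \<in> carrier A" for b
    using that assms(2) by (simp add: character_one flip: character_mult)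
  \<comment> \<open>Both characters are 0 outside the carrier, so they must differ at a point of
    it.\<close>
  obtain b where b: "b \<in> carrier A" "\<chi> b \<noteq> \<xi> b"
    using assms character_outside by (metis ext)
  let ?S = "\<Sum>a\<in>carrier A. \<chi> a * \<xi> (inv\<^bsub>A\<^esub> a)"
  have "?S = (\<Sum>a\<in>carrier A. \<chi> (b \<otimes>\<^bsub>A\<^esub> a) * \<xi> (inv\<^bsub>A\<^esub> (b \<otimes>\<^bsub>A\<^esub> a)))"
    by (rule sum.reindex_bij_witness[where i = "\<lambda>a. b \<otimes>\<^bsub>A\<^esub> a" and j = "\<lambda>a. inv\<^bsub>A\<^esub> b \<otimes>\<^bsub>A\<^esub> a"])
       (use b in \<open>auto simp: A.m_assoc[symmetric]\<close>)
  also have "\<dots> = \<chi> b * \<xi> (inv\<^bsub>A\<^esub> b) * ?S"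
    using b assms
    by (auto simp: sum_distrib_left character_mult A.inv_mult intro!: sum.cong)
  finally have "?S = 0 \<or> \<chi> b * \<xi> (inv\<^bsub>A\<^esub> b) = 1" by simp
  moreover have "\<chi> b * \<xi> (inv\<^bsub>A\<^esub> b) \<noteq> 1"
    using inv[OF b(1)] b(2) by (metis mult_cancel_right mult_zero_right zero_neq_one)
  ultimately show ?thesis by blast
qed

text \<open>A form of the linear independence of characters: the functional \<open>L\<close>,
  pairing with \<open>\<chi>\<close>, would kill every element of \<open>P\<close> and hence the
  span, whereas \<open>L \<chi>\<close> is the order of \<open>A\<close>.\<close>

lemma character_in_span:
  assumes P: "P \<subseteq> characters A" and \<chi>: "\<chi> \<in> characters A" "\<chi> \<in> cfun.span P"
  shows "\<chi> \<in> P"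
proof (rule ccontr)
  assume "\<chi> \<notin> P"
  define L where "L f = (\<Sum>a\<in>carrier A. f a * \<chi> (inv\<^bsub>A\<^esub> a))" for f
  have "L f = 0" if "f \<in> cfun.span P" for f
    using that
  proof (induction rule: cfun.span_induct_alt)
    case (step c x y)
    have "L x = 0"
      unfolding L_def using step(1) P \<chi>(1) \<open>\<chi> \<notin> P\<close>
      by (intro character_orthogonality) auto
    moreover have "L (scale_fun c x + y) = c * L x + L y"
      by (simp add: L_def scale_fun_def sum.distrib sum_distrib_left algebra_simps)
    ultimately show ?case using step.IH by (simp only: mult_zero_right add_0)
  qed (simp add: L_def)
  moreover have "L \<chi> = of_nat (card (carrier A))"
    unfolding L_def using \<chi>(1) by (simp add: character_one flip: character_mult)
  ultimately show False
    using \<chi>(2) A.order_gt_0_iff_finite finite_A by (simp add: order_def)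
qed

section \<open>Irreducibility of the span of a dual orbit\<close>

lemma dual_orbit:
  assumes "\<xi> \<in> characters A"
  shows "orbit G (dual_action A G \<rho>) \<xi> = (\<lambda>g. T (\<one>\<^bsub>A\<^esub>, g) \<xi>) ` carrier G"
    and "orbit G (dual_action A G \<rho>) \<xi> \<subseteq> characters A"
    and "\<xi> \<in> orbit G (dual_action A G \<rho>) \<xi>"
proof -
  \<comment> \<open>\<open>dual_action\<close> sets values outside the carrier to 0, so the identity
    fixes \<open>\<xi>\<close> because characters vanish there.\<close>
  have "dual_action A G \<rho> \<one>\<^bsub>G\<^esub> \<xi> = \<xi>"
    using assms by (auto simp: fun_eq_iff dual_action_apply character_outside)
  then show "\<xi> \<in> orbit G (dual_action A G \<rho>) \<xi>"
    unfolding orbit_def by (metis (mono_tags, lifting) G.one_closed mem_Collect_eq)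
qed (use assms in \<open>auto simp: orbit_def affine_representation_factor dual_action_character\<close>)

lemma characters_functions_on: "\<xi> \<in> characters A \<Longrightarrow> \<xi> \<in> functions_on (carrier A)"
  by (simp add: characters_def)

lemma dual_orbit_span_subrepresentation:
  assumes "\<xi> \<in> characters A"
  shows "subrepresentation K (cfun.span (orbit G (dual_action A G \<rho>) \<xi>)) (functions_on (carrier A)) T"
  unfolding dual_orbit(1)[OF assms]
  using character_eigenvector[OF assms]
  by (intro orbit_span_affine_invariant[OF affine_representation characters_functions_on[OF assms]]) blast

text \<open>A nonzero invariant subspace \<open>U\<close> contains a joint eigenvector of
  \<open>A\<close>, hence a character. That character belongs to \<open>P\<close>, and since
  \<open>G\<close> is transitive on \<open>P\<close>, all of \<open>P\<close> lies in
  \<open>U\<close>.\<close>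

lemma dual_orbit_span_irreducible:
  assumes \<xi>: "\<xi> \<in> characters A"
  shows "irreducible_representation K (cfun.span (orbit G (dual_action A G \<rho>) \<xi>)) T"
proof -
  define P where "P = orbit G (dual_action A G \<rho>) \<xi>"
  have P: "P = (\<lambda>g. T (\<one>\<^bsub>A\<^esub>, g) \<xi>) ` carrier G" "P \<subseteq> characters A" "\<xi> \<in> P"
    using dual_orbit[OF \<xi>] by (simp_all add: P_def)
  have sub: "subrepresentation K (cfun.span P) (functions_on (carrier A)) T"
    using dual_orbit_span_subrepresentation[OF \<xi>] by (simp add: P_def)
  have rep: "representation K (cfun.span P) T"
    by (rule subrepresentation_imp_representation[OF sub])
  have "\<xi> \<noteq> 0" using character_one[OF \<xi>] by force
  then have "cfun.span P \<noteq> {0}" using cfun.span_base[OF P(3)] by blast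
  moreover have "U = cfun.span P" if U: "subrepresentation K U (cfun.span P) T" and U0: "U \<noteq> {0}" for U
  proof -
    have UP: "U \<subseteq> cfun.span P" and subU: "cfun.subspace U"
      and inv: "\<And>k u. k \<in> carrier K \<Longrightarrow> u \<in> U \<Longrightarrow> T k u \<in> U"
      using U by (auto simp: subrepresentation_def)
    have repU: "representation K U T"
      by (rule subrepresentation_imp_representation[OF U])
    obtain f where f: "f \<in> U" "f \<noteq> 0"
      and eig: "\<And>x. x \<in> carrier A \<times> {\<one>\<^bsub>G\<^esub>} \<Longrightarrow> \<exists>c. T x f = scale_fun c f"
      by (rule joint_eigenvector[OF semidirect_group semidirect_finite repU U0,
            of "carrier A \<times> {\<one>\<^bsub>G\<^esub>}"])
         (use finite_A in \<open>auto simp: semidirect_simps A.m_comm\<close>)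
    have "f \<in> functions_on (carrier A)"
      using f(1) UP sub by (auto simp: subrepresentation_def)
    then obtain c \<chi> where \<chi>: "c \<noteq> 0" "\<chi> \<in> characters A" "f = scale_fun c \<chi>"
      using eigenvector_character[of f] f(2) eig by blast
    have "\<chi> = scale_fun (inverse c) f"
      using \<chi>(1) by (simp add: \<chi>(3))
    then have \<chi>U: "\<chi> \<in> U" using cfun.subspace_scale[OF subU f(1)] by simp
    then have "\<chi> \<in> P" using character_in_span[OF P(2) \<chi>(2)] UP by blast
    then obtain g where g: "g \<in> carrier G" "\<chi> = T (\<one>\<^bsub>A\<^esub>, g) \<xi>" using P(1) by blast
    have "T (\<one>\<^bsub>A\<^esub>, h) \<xi> \<in> U" if h: "h \<in> carrier G" for h
    proof -
      \<comment> \<open>Transitivity made explicit: \<open>h \<otimes> inv g\<close> carries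
        \<open>\<chi>\<close>, the translate of \<open>\<xi>\<close> by \<open>g\<close>, to its
        translate by \<open>h\<close>.\<close>
      have "T (\<one>\<^bsub>A\<^esub>, h \<otimes>\<^bsub>G\<^esub> inv\<^bsub>G\<^esub> g) \<chi> = T (\<one>\<^bsub>A\<^esub>, h) \<xi>"
        using g h characters_functions_on[OF \<xi>]
        by (simp add: semidirect_simps G.m_assoc flip: rep_mult[OF affine_representation])
      then show ?thesis
        using inv[OF _ \<chi>U, of "(\<one>\<^bsub>A\<^esub>, h \<otimes>\<^bsub>G\<^esub> inv\<^bsub>G\<^esub> g)"] g h by (simp add: semidirect_simps)
    qed
    then have "P \<subseteq> U" using P(1) by blast
    then show ?thesis using UP cfun.span_minimal[OF _ subU] by blast
  qed
  ultimately show ?thesis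
    using rep unfolding irreducible_representation_def P_def by blast
qed

section \<open>The zonal spherical function as a mean of characters\<close>

text \<open>Writing the mean through \<open>T\<close> makes membership in the span of the dual orbit
  immediate and matches the vector in \<open>fixed_vectors_in_span\<close>.\<close>

definition character_mean :: "('a \<Rightarrow> complex) \<Rightarrow> 'a \<Rightarrow> complex" where
  "character_mean \<xi> = scale_fun (inverse (of_nat (order G))) (\<Sum>h\<in>carrier G. T (\<one>\<^bsub>A\<^esub>, h) \<xi>)"

lemma order_G_nonzero: "of_nat (order G) \<noteq> (0 :: complex)"
  using finite_G G.order_gt_0_iff_finite by simp

text \<open>The inverses introduced by \<open>T\<close> disappear because inversion permutes
  \<open>G\<close>.\<close>

lemma character_mean_apply:
  assumes "a \<in> carrier A"
  shows "character_mean \<xi> a = (\<Sum>h\<in>carrier G. \<xi> (\<rho> h a)) / of_nat (order G)"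
proof -
  have "(\<Sum>h\<in>S. f h) x = (\<Sum>h\<in>S. f h x)" for f :: "'g \<Rightarrow> 'a \<Rightarrow> complex" and S x
    by (induction S rule: infinite_finite_induct) auto
  then have "character_mean \<xi> a = (\<Sum>h\<in>carrier G. \<xi> (\<rho> (inv\<^bsub>G\<^esub> h) a)) / of_nat (order G)"
    using assms
    by (simp add: character_mean_def scale_fun_def affine_representation_apply divide_inverse)
  also have "(\<Sum>h\<in>carrier G. \<xi> (\<rho> (inv\<^bsub>G\<^esub> h) a)) = (\<Sum>h\<in>carrier G. \<xi> (\<rho> h a))"
    by (rule sum.reindex_bij_witness[where i = "\<lambda>h. inv\<^bsub>G\<^esub> h" and j = "\<lambda>h. inv\<^bsub>G\<^esub> h"]) auto
  finally show ?thesis .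
qed

lemma sum_action_invariant:
  assumes "a \<in> carrier A" "g \<in> carrier G"
  shows "(\<Sum>h\<in>carrier G. f (\<rho> h (\<rho> g a))) = (\<Sum>h\<in>carrier G. f (\<rho> h a))"
  by (rule sum.reindex_bij_witness[where i = "\<lambda>h. h \<otimes>\<^bsub>G\<^esub> inv\<^bsub>G\<^esub> g" and j = "\<lambda>h. h \<otimes>\<^bsub>G\<^esub> g"])
     (use assms in \<open>auto simp: G.m_assoc action_comp\<close>)

lemma character_mean_in_span:
  assumes "\<xi> \<in> characters A"
  shows "character_mean \<xi> \<in> cfun.span (orbit G (dual_action A G \<rho>) \<xi>)"
  unfolding character_mean_def dual_orbit(1)[OF assms]
  by (intro cfun.span_scale cfun.span_sum cfun.span_base imageI)

lemma character_mean_one: "\<xi> \<in> characters A \<Longrightarrow> character_mean \<xi> \<one>\<^bsub>A\<^esub> = 1"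
  using order_G_nonzero by (simp add: character_mean_apply character_one order_def)

lemma character_mean_invariant:
  "a \<in> carrier A \<Longrightarrow> g \<in> carrier G \<Longrightarrow> character_mean \<xi> (\<rho> g a) = character_mean \<xi> a"
  by (simp add: character_mean_apply sum_action_invariant)

text \<open>This matches the invariance clause of \<open>is_zonal_spherical\<close> with fixed
  vectors. That clause only concerns points of \<open>A\<close>; elsewhere \<open>v\<close> and its
  translates are both 0.\<close>

lemma fixed_vectors_invariant:
  assumes "V \<subseteq> functions_on (carrier A)"
  shows "v \<in> fixed_vectors (embedded_factor A G) V T
    \<longleftrightarrow> v \<in> V \<and> (\<forall>g\<in>carrier G. \<forall>a\<in>carrier A. v (\<rho> g a) = v a)"
proof -
  have "(\<forall>g\<in>carrier G. T (\<one>\<^bsub>A\<^esub>, g) v = v) \<longleftrightarrow> (\<forall>g\<in>carrier G. \<forall>a\<in>carrier A. v (\<rho> g a) = v a)"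
    if "v \<in> V"
  proof
    assume L: "\<forall>g\<in>carrier G. T (\<one>\<^bsub>A\<^esub>, g) v = v"
    show "\<forall>g\<in>carrier G. \<forall>a\<in>carrier A. v (\<rho> g a) = v a"
    proof (intro ballI)
      fix g a assume "g \<in> carrier G" "a \<in> carrier A"
      \<comment> \<open>The inverse of \<open>g\<close> is inserted so that the inversion inside
        \<open>T\<close> yields \<open>\<rho> g a\<close>.\<close>
      with L[rule_format, of "inv\<^bsub>G\<^esub> g", THEN fun_cong, of a] show "v (\<rho> g a) = v a"
        by (simp add: affine_representation_apply)
    qed
  next
    assume "\<forall>g\<in>carrier G. \<forall>a\<in>carrier A. v (\<rho> g a) = v a"
    then show "\<forall>g\<in>carrier G. T (\<one>\<^bsub>A\<^esub>, g) v = v"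
      using that assms by (auto simp: affine_representation_apply fun_eq_iff functions_on_def)
  qed
  then show ?thesis by (auto simp: fixed_vectors_def embedded_factor_def)
qed

text \<open>The equality serves twice: for the dimension 1 in the definition of a spherical
  representation, and for the uniqueness of the zonal spherical function.\<close>

lemma fixed_vectors_dual_orbit_span:
  assumes \<xi>: "\<xi> \<in> characters A"
  shows "fixed_vectors (embedded_factor A G) (cfun.span (orbit G (dual_action A G \<rho>) \<xi>)) T
    = cfun.span {character_mean \<xi>}"
proof -
  define W where "W = cfun.span (orbit G (dual_action A G \<rho>) \<xi>)"
  have sub: "subrepresentation K W (functions_on (carrier A)) T"
    unfolding W_def by (rule dual_orbit_span_subrepresentation[OF \<xi>])
  have WF: "W \<subseteq> functions_on (carrier A)" using sub by (simp add: subrepresentation_def)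
  have rep: "representation K W T" by (rule subrepresentation_imp_representation[OF sub])
  have "\<xi> \<in> W" unfolding W_def by (rule cfun.span_base[OF dual_orbit(3)[OF \<xi>]])
  then have "fixed_vectors (embedded_factor A G) W T
      \<subseteq> cfun.span {\<Sum>h\<in>carrier G. T (\<one>\<^bsub>A\<^esub>, h) \<xi>}"
    by (rule fixed_vectors_in_span[OF rep]) (simp add: W_def dual_orbit(1)[OF \<xi>])
  also have "\<dots> \<subseteq> cfun.span {character_mean \<xi>}"
  proof (intro cfun.span_minimal cfun.subspace_span)
    have "(\<Sum>h\<in>carrier G. T (\<one>\<^bsub>A\<^esub>, h) \<xi>) = scale_fun (of_nat (order G)) (character_mean \<xi>)"
      using order_G_nonzero by (simp add: character_mean_def)
    then show "{\<Sum>h\<in>carrier G. T (\<one>\<^bsub>A\<^esub>, h) \<xi>} \<subseteq> cfun.span {character_mean \<xi>}"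
      by (simp add: cfun.span_base cfun.span_scale)
  qed
  moreover have "cfun.span {character_mean \<xi>} \<subseteq> fixed_vectors (embedded_factor A G) W T"
  proof (rule subsetI)
    fix v assume "v \<in> cfun.span {character_mean \<xi>}"
    then obtain c where v: "v = scale_fun c (character_mean \<xi>)" by (auto simp: cfun.span_singleton)
    have "v \<in> W" unfolding v W_def by (intro cfun.span_scale character_mean_in_span[OF \<xi>])
    then show "v \<in> fixed_vectors (embedded_factor A G) W T"
      by (simp add: fixed_vectors_invariant[OF WF] v scale_fun_def character_mean_invariant)
  qed
  ultimately show ?thesis unfolding W_def by blast
qed

text \<open>The description by \<open>THE\<close> calls for existence and uniqueness. Any candidate
  lies in the line of fixed vectors spanned by the mean, and the value 1 at the identity determines
  the scalar.\<close>

lemma zonal_spherical_character_mean: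
  assumes \<xi>: "\<xi> \<in> characters A"
  shows "zonal_spherical_function A G \<rho> (cfun.span (orbit G (dual_action A G \<rho>) \<xi>)) = character_mean \<xi>"
  unfolding zonal_spherical_function_def
proof (rule the_equality)
  let ?W = "cfun.span (orbit G (dual_action A G \<rho>) \<xi>)"
  have WF: "?W \<subseteq> functions_on (carrier A)"
    using dual_orbit_span_subrepresentation[OF \<xi>] by (simp add: subrepresentation_def)
  have nz: "character_mean \<xi> \<noteq> 0"
    using character_mean_one[OF \<xi>] by force
  have "cfun.dim (fixed_vectors (embedded_factor A G) ?W T) = 1"
    unfolding fixed_vectors_dual_orbit_span[OF \<xi>]
    using nz cfun.dim_eq_card_independent[of "{character_mean \<xi>}"] by simp
  then show "is_zonal_spherical A G \<rho> ?W (character_mean \<xi>)"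
    using semidirect_gelfand_pair dual_orbit_span_subrepresentation[OF \<xi>]
      dual_orbit_span_irreducible[OF \<xi>] character_mean_in_span[OF \<xi>]
    by (simp add: is_zonal_spherical_def spherical_representation_def
        character_mean_one[OF \<xi>] character_mean_invariant)
  fix \<omega> assume \<omega>: "is_zonal_spherical A G \<rho> ?W \<omega>"
  then have "\<omega> \<in> fixed_vectors (embedded_factor A G) ?W T"
    by (simp add: fixed_vectors_invariant[OF WF] is_zonal_spherical_def)
  then obtain c where "\<omega> = scale_fun c (character_mean \<xi>)"
    by (auto simp: fixed_vectors_dual_orbit_span[OF \<xi>] cfun.span_singleton)
  moreover have "\<omega> \<one>\<^bsub>A\<^esub> = 1" using \<omega> by (simp add: is_zonal_spherical_def)
  ultimately show "\<omega> = character_mean \<xi>"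
    using character_mean_one[OF \<xi>] by (simp add: scale_fun_def)
qed

section \<open>Sums over orbits and the canonical matrix\<close>

text \<open>\<open>\<rho> g\<close> permutes the orbit.\<close>

lemma sum_orbit_action:
  assumes "a \<in> carrier A" "g \<in> carrier G"
  shows "(\<Sum>b\<in>orbit G \<rho> a. f (\<rho> g b)) = (\<Sum>b\<in>orbit G \<rho> a. f b)"
proof (rule sum.reindex_bij_witness[where i = "\<rho> (inv\<^bsub>G\<^esub> g)" and j = "\<rho> g"])
  have act: "\<rho> h b \<in> orbit G \<rho> a" if "h \<in> carrier G" "b \<in> orbit G \<rho> a" for h b
    using that assms(1) unfolding orbit_def
    by (auto simp flip: action_comp)
  fix b assume "b \<in> orbit G \<rho> a"
  then show "\<rho> (inv\<^bsub>G\<^esub> g) b \<in> orbit G \<rho> a" "\<rho> g b \<in> orbit G \<rho> a"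
    and "\<rho> (inv\<^bsub>G\<^esub> g) (\<rho> g b) = b" "\<rho> g (\<rho> (inv\<^bsub>G\<^esub> g) b) = b"
    using assms act by (auto simp: orbit_def)
qed auto

text \<open>Double counting in place of the orbit-stabilizer theorem: the sum of
  \<open>f (\<rho> h b)\<close> over all \<open>h\<close> in \<open>G\<close> and \<open>b\<close>
  in the orbit has inner sums independent of \<open>b\<close> in one order and of \<open>h\<close>
  in the other.\<close>

lemma orbit_average:
  fixes f :: "'a \<Rightarrow> complex"
  assumes a: "a \<in> carrier A"
  shows "(\<Sum>h\<in>carrier G. f (\<rho> h a)) / of_nat (order G)
    = (\<Sum>b\<in>orbit G \<rho> a. f b) / of_nat (card (orbit G \<rho> a))"
proof -
  let ?O = "orbit G \<rho> a"
  have "finite ?O" "?O \<noteq> {}"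
    using finite_G by (auto simp: orbit_def intro: G.one_closed)
  then have nz: "of_nat (card ?O) \<noteq> (0 :: complex)" by simp
  have "of_nat (card ?O) * (\<Sum>h\<in>carrier G. f (\<rho> h a)) = (\<Sum>b\<in>?O. \<Sum>h\<in>carrier G. f (\<rho> h b))"
  proof -
    have "(\<Sum>h\<in>carrier G. f (\<rho> h b)) = (\<Sum>h\<in>carrier G. f (\<rho> h a))" if "b \<in> ?O" for b
      using that a by (auto simp: orbit_def sum_action_invariant)
    then show ?thesis by simp
  qed
  also have "\<dots> = (\<Sum>h\<in>carrier G. \<Sum>b\<in>?O. f (\<rho> h b))" by (rule sum.swap)
  also have "\<dots> = of_nat (order G) * (\<Sum>b\<in>?O. f b)"
    using a by (simp add: sum_orbit_action order_def)
  finally show ?thesis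
    using nz order_G_nonzero by (simp add: field_simps)
qed

lemma common_valueI:
  assumes "S \<noteq> {}" "\<And>x. x \<in> S \<Longrightarrow> f x = c"
  shows "common_value f S = c"
  unfolding common_value_def using assms by (intro the_equality) auto

text \<open>The sum does not depend on the character chosen in its orbit: translating
  \<open>\<xi>\<close> by \<open>g\<close> amounts to permuting the orbit of \<open>a\<close> by the
  inverse of \<open>g\<close>.\<close>

lemma canonical_matrix_orbits:
  assumes \<xi>: "\<xi> \<in> characters A" and a: "a \<in> carrier A"
  shows "canonical_matrix (orbit G (dual_action A G \<rho>) \<xi>) (orbit G \<rho> a)
    = (\<Sum>b\<in>orbit G \<rho> a. cnj (\<xi> b))"
  unfolding canonical_matrix_def
proof (rule common_valueI)
  fix \<chi> assume "\<chi> \<in> orbit G (dual_action A G \<rho>) \<xi>"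
  then obtain g where g: "g \<in> carrier G" "\<chi> = dual_action A G \<rho> g \<xi>" by (auto simp: orbit_def)
  have "(\<Sum>b\<in>orbit G \<rho> a. cnj (\<chi> b)) = (\<Sum>b\<in>orbit G \<rho> a. cnj (\<xi> (\<rho> (inv\<^bsub>G\<^esub> g) b)))"
    using a g by (intro sum.cong) (auto simp: orbit_def dual_action_apply)
  also have "\<dots> = (\<Sum>b\<in>orbit G \<rho> a. cnj (\<xi> b))"
    using g by (intro sum_orbit_action[OF a]) auto
  finally show "(\<Sum>b\<in>orbit G \<rho> a. cnj (\<chi> b)) = (\<Sum>b\<in>orbit G \<rho> a. cnj (\<xi> b))" .
qed (use dual_orbit(3)[OF \<xi>] in blast)

end

theorem corollary2p3p2:
  fixes A :: "('a, 'm) monoid_scheme" and G :: "('g, 'n) monoid_scheme"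
    and \<rho> :: "'g \<Rightarrow> 'a \<Rightarrow> 'a" and Orb :: "'a set" and P :: "('a \<Rightarrow> complex) set"
  assumes "comm_group A" and "finite (carrier A)"
    and "group G" and "finite (carrier G)"
    and "\<rho> \<in> hom G (AutoGroup A)"
    and "Orb \<in> orbits G (carrier A) \<rho>"
    and "P \<in> orbits G (characters A) (dual_action A G \<rho>)"
  shows "common_value (zonal_spherical_function A G \<rho> (cfun.span P)) Orb
    = 1 / of_nat (card Orb) * cnj (canonical_matrix P Orb)"
proof -
  interpret A: comm_group A by fact
  interpret G: group G by fact
  interpret automorphism_action A G \<rho>
    by unfold_locales (use assms in auto)
  obtain a where a: "a \<in> carrier A" "Orb = orbit G \<rho> a"
    using assms(6) by (auto simp: orbits_def)
  obtain \<xi> where \<xi>: "\<xi> \<in> characters A" "P = orbit G (dual_action A G \<rho>) \<xi>"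
    using assms(7) by (auto simp: orbits_def)
  \<comment> \<open>By invariance the mean has the same value at each point of the orbit as at
    \<open>a\<close>, where \<open>orbit_average\<close> turns the mean over \<open>G\<close> into
    the mean over the orbit.\<close>
  have "common_value (character_mean \<xi>) Orb = (\<Sum>b\<in>Orb. \<xi> b) / of_nat (card Orb)"
  proof (rule common_valueI)
    show "Orb \<noteq> {}" using a by (auto simp: orbit_def intro: G.one_closed)
    fix b assume "b \<in> Orb"
    then obtain g where g: "g \<in> carrier G" "b = \<rho> g a" using a by (auto simp: orbit_def)
    then have "character_mean \<xi> b = character_mean \<xi> a"
      using a by (simp add: character_mean_invariant)
    then show "character_mean \<xi> b = (\<Sum>b\<in>Orb. \<xi> b) / of_nat (card Orb)"
      using a by (simp add: character_mean_apply orbit_average)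
  qed
  \<comment> \<open>The conjugate in the claim undoes the one inside the canonical matrix.\<close>
  then show ?thesis
    using zonal_spherical_character_mean[OF \<xi>(1)] canonical_matrix_orbits[OF \<xi>(1) a(1)]
    by (simp add: a(2) \<xi>(2))
qed

end
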